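(* Let $F$ be any probability distribution on $\mathbb{R}$ with right-unbounded support, and let $g:\mathbb{R}\to[0,\infty)$ be any non-negative increasing function satisfying $\lim_{x\to\infty} g(x)=\infty$. Then there exist independent real-valued random variables $\xi_1$ and $\xi_2$ such that the distribution of $\min(\xi_1,\xi_2)$ is $F$, and $$\mathbb{E}\, g(\xi_1)=\mathbb{E}\, g(\xi_2)=\infty.$$
   Context: The same symbol $F$ denotes a probability distribution on the real line and its distribution function $F(x)$. The distribution $F$ has right-unbounded support if $F(x)<1$ for all $x\in\mathbb{R}$. *)

theory Defs
  imports "HOL-Probability.Probability"
begin

end

theory Submission
  imports Defs
begin

text \<open>
  Let \<open>h = - ln (1 - F)\<close> be the cumulative hazard of \<open>F\<close>. The tail of a minimum of two independent
  variables is the product of their tails, so their cumulative hazards add up; conversely every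
  splitting of \<open>h\<close> into two cumulative hazards \<open>h\<^sub>1 + h\<^sub>2\<close> yields the required pair. Such a splitting
  comes from any Borel set \<open>A\<close>: the Lebesgue-Stieltjes measure of \<open>h\<close> is the sum of its restrictions
  to \<open>A\<close> and to the complement of \<open>A\<close>.

  Take \<open>A\<close> to consist of every other block \<open>{x n<..x (n + 1)}\<close> of a sequence \<open>x\<close> that grows so
  fast that two things hold. First, \<open>h\<close> grows by at least \<open>n\<close> on the \<open>n\<close>-th block, so that each of
  \<open>h\<^sub>1\<close>, \<open>h\<^sub>2\<close>, which receives infinitely many blocks, is unbounded and hence the hazard of a
  variable that is finite almost surely. Secondly, \<open>g (x (n + 1))\<close> is at least
  \<open>n\<close> times \<open>exp (h (x n))\<close>. On a block that \<open>h\<^sub>1\<close> does not receive, the tail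
  \<open>exp (- h\<^sub>1)\<close> stays at its value at \<open>x n\<close>, which is at least \<open>exp (- h (x n))\<close>; hence Markov's
  inequality at \<open>x (n + 1)\<close> bounds the expectation of \<open>g\<close> from below by \<open>n\<close>. As each of the two
  variables misses infinitely many blocks, both expectations are infinite.
\<close>

section \<open>Splitting a cumulative hazard along a Borel set\<close>

text \<open>Hazards with a finite limit at \<open>\<infinity>\<close> are included, because restricting to a Borel set can
  produce them; these describe variables that take the value \<open>\<infinity>\<close> with positive probability.\<close>

locale cumulative_hazard =
  fixes h :: "real \<Rightarrow> real"
  assumes hazard_mono: "x \<le> y \<Longrightarrow> h x \<le> h y"
    and hazard_right_cont: "continuous (at_right a) h"
    and hazard_at_bot: "(h \<longlongrightarrow> 0) at_bot"
begin

definition part :: "real set \<Rightarrow> real \<Rightarrow> real"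
  where "part A x = measure (interval_measure h) ({..x} \<inter> A)"

lemma hazard_nonneg: "0 \<le> h x"
  using hazard_at_bot
  by (rule tendsto_upperbound)
    (auto simp: eventually_at_bot_linorder hazard_mono intro!: exI[of _ x])

lemma fmeasurable_part:
  assumes "A \<in> sets borel"
  shows "{..x} \<inter> A \<in> fmeasurable (interval_measure h)"
proof (rule fmeasurableI2)
  show "{..x} \<in> fmeasurable (interval_measure h)"
    by (rule fmeasurableI)
      (simp_all add: emeasure_interval_measure_Iic[OF hazard_mono hazard_right_cont hazard_at_bot])
qed (use assms in auto)

lemma part_add_part_Compl:
  assumes "A \<in> sets borel"
  shows "part A x + part (- A) x = h x"
proof -
  have "part A x + part (- A) x = measure (interval_measure h) (({..x} \<inter> A) \<union> ({..x} \<inter> - A))"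
    unfolding part_def using assms
    by (intro measure_Un3[OF fmeasurable_part fmeasurable_part, THEN trans, symmetric]) auto
  also have "({..x} \<inter> A) \<union> ({..x} \<inter> - A) = {..x}"
    by auto
  finally show ?thesis
    by (simp add: measure_interval_measure_Iic[OF hazard_mono hazard_right_cont hazard_at_bot])
qed

lemma part_mono:
  assumes "A \<in> sets borel" and "x \<le> y"
  shows "part A x \<le> part A y"
  unfolding part_def using assms
  by (intro measure_mono_fmeasurable fmeasurable_part) auto

lemma part_nonneg: "0 \<le> part A x"
  by (simp add: part_def)

lemma part_le_hazard: "A \<in> sets borel \<Longrightarrow> part A x \<le> h x"
  using part_add_part_Compl[of A x] part_nonneg[of "- A" x] by simp

text \<open>Both parts are monotone and add up to \<open>h\<close>, so neither can grow faster than \<open>h\<close>.\<close>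

lemma part_diff_le:
  assumes "A \<in> sets borel" and "x \<le> y"
  shows "part A y - part A x \<le> h y - h x"
  using part_add_part_Compl[OF assms(1), of x] part_add_part_Compl[OF assms(1), of y]
    part_mono[of "- A" x y] assms
  by auto

lemma part_eq_if_disjoint:
  assumes "x \<le> y" and "{x<..y} \<inter> A = {}"
  shows "part A y = part A x"
proof -
  have "{..y} = {..x} \<union> {x<..y}"
    using assms(1) by auto
  then have "{..y} \<inter> A = {..x} \<inter> A"
    using assms(2) by (simp add: Int_Un_distrib2)
  then show ?thesis
    by (simp add: part_def)
qed

lemma part_ge_if_subset:
  assumes "A \<in> sets borel" and "x \<le> y" and "{x<..y} \<subseteq> A"
  shows "h y - h x \<le> part A y"
proof -
  have "part (- A) y = part (- A) x"
    using assms by (intro part_eq_if_disjoint) auto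
  then show ?thesis
    using part_add_part_Compl[OF assms(1), of x] part_add_part_Compl[OF assms(1), of y]
      part_nonneg[of A x]
    by linarith
qed

text \<open>A part inherits right-continuity and the limit at \<open>-\<infinity>\<close> from \<open>h\<close> because its increments are
  squeezed between \<open>0\<close> and those of \<open>h\<close>. Its divergence at \<open>\<infinity>\<close> is not inherited.\<close>

lemma cumulative_hazard_part:
  assumes A: "A \<in> sets borel"
  shows "cumulative_hazard (part A)"
proof
  fix a :: real
  have "((\<lambda>y. part A y - part A a) \<longlongrightarrow> 0) (at_right a)"
  proof (rule tendsto_sandwich[where f = "\<lambda>_. 0" and h = "\<lambda>y. h y - h a"])
    show "\<forall>\<^sub>F y in at_right a. 0 \<le> part A y - part A a"
      using A by (auto simp: eventually_at_filter part_mono)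
    show "\<forall>\<^sub>F y in at_right a. part A y - part A a \<le> h y - h a"
      using A by (auto simp: eventually_at_filter part_diff_le)
    show "((\<lambda>y. h y - h a) \<longlongrightarrow> 0) (at_right a)"
      using hazard_right_cont[of a] by (simp add: continuous_within LIM_zero)
  qed simp
  then show "continuous (at_right a) (part A)"
    by (simp add: continuous_within LIM_zero_cancel)
next
  show "(part A \<longlongrightarrow> 0) at_bot"
    by (rule tendsto_sandwich[OF _ _ tendsto_const hazard_at_bot])
      (auto simp: part_nonneg part_le_hazard A)
qed (use A part_mono in auto)

end

section \<open>Hazards and distributions\<close>

lemma (in real_distribution) measure_Ioi: "measure M {x<..} = 1 - cdf M x"
proof -
  have "measure M (space M - {..x}) = 1 - measure M {..x}"
    by (rule prob_compl) simp
  moreover have "space M - {..x} = {x<..}"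
    by auto
  ultimately show ?thesis
    by (simp add: cdf_def)
qed

lemma cumulative_hazard_of_distribution:
  assumes "real_distribution F" and "\<forall>x. cdf F x < 1"
  shows "cumulative_hazard (\<lambda>x. - ln (1 - cdf F x))"
    and "filterlim (\<lambda>x. - ln (1 - cdf F x)) at_top at_top"
proof -
  interpret real_distribution F by fact
  have pos: "0 < 1 - cdf F x" for x
    using assms(2) by simp
  show "cumulative_hazard (\<lambda>x. - ln (1 - cdf F x))"
  proof
    show "- ln (1 - cdf F x) \<le> - ln (1 - cdf F y)" if "x \<le> y" for x y
      using cdf_nondecreasing[OF that] pos[of x] pos[of y] by simp
    show "continuous (at_right a) (\<lambda>x. - ln (1 - cdf F x))" for a
      using cdf_is_right_cont[of a] pos[of a] unfolding continuous_within
      by (intro tendsto_intros) auto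
    have "((\<lambda>x. - ln (1 - cdf F x)) \<longlongrightarrow> - ln (1 - 0)) at_bot"
      by (intro tendsto_intros cdf_lim_at_bot) auto
    then show "((\<lambda>x. - ln (1 - cdf F x)) \<longlongrightarrow> 0) at_bot"
      by simp
  qed
  have "((\<lambda>x. 1 - cdf F x) \<longlongrightarrow> 1 - 1) at_top"
    by (intro tendsto_intros cdf_lim_at_top_prob)
  then have "filterlim (\<lambda>x. 1 - cdf F x) (at_right 0) at_top"
    using pos by (intro tendsto_imp_filterlim_at_right) simp_all
  then have "filterlim (\<lambda>x. ln (1 - cdf F x)) at_bot at_top"
    by (rule filterlim_compose[OF ln_at_0])
  then show "filterlim (\<lambda>x. - ln (1 - cdf F x)) at_top at_top"
    by (simp add: filterlim_uminus_at_top)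
qed

text \<open>Conversely, a hazard that diverges belongs to a probability distribution; divergence
  keeps mass from escaping to infinity.\<close>

lemma distribution_of_cumulative_hazard:
  assumes "cumulative_hazard h" and lim: "filterlim h at_top at_top"
  obtains P where "real_distribution P" and "\<And>x. cdf P x = 1 - exp (- h x)"
proof -
  interpret cumulative_hazard h by fact
  let ?G = "\<lambda>x. 1 - exp (- h x)"
  have mono: "?G x \<le> ?G y" if "x \<le> y" for x y
    using hazard_mono[OF that] by simp
  have cont: "continuous (at_right a) ?G" for a
    using hazard_right_cont[of a] by (intro continuous_intros)
  have "(?G \<longlongrightarrow> 1 - exp (- 0)) at_bot"
    by (intro tendsto_intros hazard_at_bot)
  then have bot: "(?G \<longlongrightarrow> 0) at_bot"
    by simp
  have "filterlim (\<lambda>x. - h x) at_bot at_top"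
    using lim by (simp add: filterlim_uminus_at_top)
  then have "((\<lambda>x. exp (- h x)) \<longlongrightarrow> 0) at_top"
    by (rule filterlim_compose[OF exp_at_bot])
  then have "(?G \<longlongrightarrow> 1 - 0) at_top"
    by (intro tendsto_intros)
  then have "real_distribution (interval_measure ?G)"
    using mono cont bot by (intro real_distribution_interval_measure) auto
  moreover have "cdf (interval_measure ?G) = ?G"
    using mono cont bot by (rule cdf_interval_measure)
  ultimately show thesis
    by (intro that[of "interval_measure ?G"]) (simp_all add: fun_eq_iff)
qed

section \<open>Independent coordinates and their minimum\<close>

lemma coordinates_of_product_distribution:
  fixes P Q :: "real measure"
  assumes "real_distribution P" and "real_distribution Q"
  shows "prob_space (P \<Otimes>\<^sub>M Q)"
    and "distr (P \<Otimes>\<^sub>M Q) borel fst = P"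
    and "distr (P \<Otimes>\<^sub>M Q) borel snd = Q"
    and "prob_space.indep_var (P \<Otimes>\<^sub>M Q) borel fst borel snd"
    and "cdf (distr (P \<Otimes>\<^sub>M Q) borel (\<lambda>\<omega>. min (fst \<omega>) (snd \<omega>))) x =
      1 - (1 - cdf P x) * (1 - cdf Q x)"
proof -
  interpret P: real_distribution P by fact
  interpret Q: real_distribution Q by fact
  interpret PQ: pair_prob_space P Q ..
  have [measurable]: "fst \<in> borel_measurable (P \<Otimes>\<^sub>M Q)" "snd \<in> borel_measurable (P \<Otimes>\<^sub>M Q)"
    using measurable_fst[of P Q] measurable_snd[of P Q]
    by (simp_all cong: measurable_cong_sets)
  show "prob_space (P \<Otimes>\<^sub>M Q)"
    by (rule PQ.prob_space_axioms)
  have "distr (P \<Otimes>\<^sub>M Q) borel fst = distr (P \<Otimes>\<^sub>M Q) P fst"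
    by (rule distr_cong) auto
  then show fst: "distr (P \<Otimes>\<^sub>M Q) borel fst = P"
    by (simp add: Q.distr_pair_fst)
  show snd: "distr (P \<Otimes>\<^sub>M Q) borel snd = Q"
  proof (rule measure_eqI)
    fix B :: "real set"
    assume "B \<in> sets (distr (P \<Otimes>\<^sub>M Q) borel snd)"
    moreover have "snd -` B \<inter> space (P \<Otimes>\<^sub>M Q) = UNIV \<times> B"
      by (auto simp: space_pair_measure)
    ultimately show "emeasure (distr (P \<Otimes>\<^sub>M Q) borel snd) B = emeasure Q B"
      using P.emeasure_space_1
      by (simp add: emeasure_distr Q.emeasure_pair_measure_Times)
  qed simp
  have "distr (P \<Otimes>\<^sub>M Q) (borel \<Otimes>\<^sub>M borel) (\<lambda>\<omega>. (fst \<omega>, snd \<omega>)) = P \<Otimes>\<^sub>M Q"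
    unfolding prod.collapse
    by (intro distr_id2 sets_pair_measure_cong) simp_all
  then show "prob_space.indep_var (P \<Otimes>\<^sub>M Q) borel fst borel snd"
    by (simp add: PQ.indep_var_distribution_eq fst snd)
  let ?D = "distr (P \<Otimes>\<^sub>M Q) borel (\<lambda>\<omega>. min (fst \<omega>) (snd \<omega>))"
  interpret D: real_distribution ?D
    by (rule PQ.real_distribution_distr) measurable
  have "measure ?D {x<..} = measure (P \<Otimes>\<^sub>M Q) ({x<..} \<times> {x<..})"
  proof (subst measure_distr)
    have "(\<lambda>\<omega>. min (fst \<omega>) (snd \<omega>)) -` {x<..} \<inter> space (P \<Otimes>\<^sub>M Q) = {x<..} \<times> {x<..}"
      by (auto simp: space_pair_measure)
    then show "measure (P \<Otimes>\<^sub>M Q) ((\<lambda>\<omega>. min (fst \<omega>) (snd \<omega>)) -` {x<..} \<inter> space (P \<Otimes>\<^sub>M Q)) =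
        measure (P \<Otimes>\<^sub>M Q) ({x<..} \<times> {x<..})"
      by simp
  qed simp_all
  also have "\<dots> = measure P {x<..} * measure Q {x<..}"
    by (simp add: measure_def Q.emeasure_pair_measure_Times enn2real_mult)
  finally show "cdf ?D x = 1 - (1 - cdf P x) * (1 - cdf Q x)"
    using D.measure_Ioi[of x] P.measure_Ioi[of x] Q.measure_Ioi[of x] by simp
qed

section \<open>Tails that keep still for long\<close>

lemma tail_times_value_le_expectation:
  assumes "real_distribution P" and "\<forall>x. 0 \<le> g x" and "mono g"
  shows "ennreal (g x * (1 - cdf P x)) \<le> (\<integral>\<^sup>+ y. ennreal (g y) \<partial>P)"
proof -
  interpret P: real_distribution P by fact
  have tail: "emeasure P {x<..} = ennreal (1 - cdf P x)"
    by (simp add: P.emeasure_eq_measure P.measure_Ioi)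
  have "ennreal (g x * (1 - cdf P x)) = (\<integral>\<^sup>+ y. ennreal (g x) * indicator {x<..} y \<partial>P)"
    using assms(2) P.cdf_bounded_prob[of x]
    by (simp add: nn_integral_cmult_indicator tail ennreal_mult)
  also have "\<dots> \<le> (\<integral>\<^sup>+ y. ennreal (g y) \<partial>P)"
    using monoD[OF assms(3)]
    by (intro nn_integral_mono) (auto simp: indicator_def intro!: ennreal_leI)
  finally show ?thesis .
qed

text \<open>The blocks inside \<open>A\<close> make the partial hazard diverge, those outside \<open>A\<close> make the expectation
  infinite. The hypotheses are symmetric under exchanging \<open>A\<close> with its complement, so one lemma
  serves both variables.\<close>

lemma (in cumulative_hazard) heavy_distribution_of_part:
  fixes x :: "nat \<Rightarrow> real"
  assumes A: "A \<in> sets borel"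
    and g: "\<forall>y. 0 \<le> g y" "mono g"
    and less: "\<And>n. x n < x (Suc n)"
    and hazard_grows: "\<And>n. h (x n) + real n \<le> h (x (Suc n))"
    and g_grows: "\<And>n. real n * exp (h (x n)) \<le> g (x (Suc n))"
    and inside: "\<And>N. \<exists>n\<ge>N. {x n<..x (Suc n)} \<subseteq> A"
    and outside: "\<And>N. \<exists>n\<ge>N. {x n<..x (Suc n)} \<inter> A = {}"
  obtains P where "real_distribution P" and "\<And>y. cdf P y = 1 - exp (- part A y)"
    and "(\<integral>\<^sup>+ y. ennreal (g y) \<partial>P) = \<infinity>"
proof -
  have "\<exists>y. \<forall>z\<ge>y. c \<le> part A z" for c
  proof -
    obtain n where n: "nat \<lceil>c\<rceil> \<le> n" "{x n<..x (Suc n)} \<subseteq> A"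
      using inside by blast
    have "c \<le> real n"
      using n(1) by linarith
    also have "\<dots> \<le> h (x (Suc n)) - h (x n)"
      using hazard_grows[of n] by simp
    also have "\<dots> \<le> part A (x (Suc n))"
      using A less[of n] n(2) by (intro part_ge_if_subset) auto
    finally show ?thesis
      using part_mono[OF A] by (meson order_trans)
  qed
  then have "filterlim (part A) at_top at_top"
    by (simp add: filterlim_at_top eventually_at_top_linorder)
  with cumulative_hazard_part[OF A]
  obtain P where P: "real_distribution P" and cdf: "\<And>y. cdf P y = 1 - exp (- part A y)"
    by (rule distribution_of_cumulative_hazard) blast
  have "of_nat N \<le> (\<integral>\<^sup>+ y. ennreal (g y) \<partial>P)" for N
  proof -
    obtain n where n: "N \<le> n" "{x n<..x (Suc n)} \<inter> A = {}"
      using outside by blast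
    have "part A (x (Suc n)) = part A (x n)"
      using less[of n] n(2) by (intro part_eq_if_disjoint) auto
    then have tail: "exp (- h (x n)) \<le> 1 - cdf P (x (Suc n))"
      using part_le_hazard[OF A, of "x n"] by (simp add: cdf)
    have "real N \<le> real n * exp (h (x n)) * exp (- h (x n))"
      using n(1) by (simp add: mult.assoc flip: exp_add)
    also have "\<dots> \<le> g (x (Suc n)) * (1 - cdf P (x (Suc n)))"
      using g_grows[of n] tail g(1) by (intro mult_mono) auto
    finally have "ennreal (real N) \<le> ennreal (g (x (Suc n)) * (1 - cdf P (x (Suc n))))"
      by (rule ennreal_leI)
    also have "\<dots> \<le> (\<integral>\<^sup>+ y. ennreal (g y) \<partial>P)"
      by (rule tail_times_value_le_expectation[OF P g])
    finally show ?thesis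
      by (simp add: ennreal_of_nat_eq_real_of_nat)
  qed
  then have "\<not> (\<integral>\<^sup>+ y. ennreal (g y) \<partial>P) < top"
    using ennreal_Ex_less_of_nat leD by blast
  then have "(\<integral>\<^sup>+ y. ennreal (g y) \<partial>P) = \<infinity>"
    unfolding infinity_ennreal_def using top.not_eq_extremum by blast
  with P cdf show thesis
    by (rule that)
qed

lemma sparse_sequence_exists:
  fixes h g :: "real \<Rightarrow> real"
  assumes "filterlim h at_top at_top" and "filterlim g at_top at_top"
  obtains x :: "nat \<Rightarrow> real" where "\<And>n. x n < x (Suc n)"
    and "\<And>n. h (x n) + real n \<le> h (x (Suc n))"
    and "\<And>n. real n * exp (h (x n)) \<le> g (x (Suc n))"
proof -
  have "\<exists>z. y < z \<and> h y + real n \<le> h z \<and> real n * exp (h y) \<le> g z" for y n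
  proof -
    have "\<forall>\<^sub>F z in at_top. y < z \<and> h y + real n \<le> h z \<and> real n * exp (h y) \<le> g z"
      using assms by (intro eventually_conj eventually_gt_at_top) (auto simp: filterlim_at_top)
    then show ?thesis
      by (rule eventually_happens'[rotated]) simp
  qed
  then have "\<exists>x :: nat \<Rightarrow> real. \<forall>n. True \<and>
      (x n < x (Suc n) \<and> h (x n) + real n \<le> h (x (Suc n)) \<and> real n * exp (h (x n)) \<le> g (x (Suc n)))"
    by (intro dependent_nat_choice) auto
  with that show thesis
    by blast
qed

section \<open>The decomposition of the minimum\<close>

theorem theorem1p2:
  fixes F :: "real measure" and g :: "real \<Rightarrow> real"
  assumes "real_distribution F"
    and "\<forall>x. cdf F x < 1"
    and "\<forall>x. 0 \<le> g x"
    and "mono g"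
    and "filterlim g at_top at_top"
  shows "\<exists>(M :: (real \<times> real) measure) \<xi>\<^sub>1 \<xi>\<^sub>2.
    prob_space M \<and>
    \<xi>\<^sub>1 \<in> borel_measurable M \<and>
    \<xi>\<^sub>2 \<in> borel_measurable M \<and>
    prob_space.indep_var M borel \<xi>\<^sub>1 borel \<xi>\<^sub>2 \<and>
    distr M borel (\<lambda>\<omega>. min (\<xi>\<^sub>1 \<omega>) (\<xi>\<^sub>2 \<omega>)) = F \<and>
    (\<integral>\<^sup>+ \<omega>. ennreal (g (\<xi>\<^sub>1 \<omega>)) \<partial>M) = \<infinity> \<and>
    (\<integral>\<^sup>+ \<omega>. ennreal (g (\<xi>\<^sub>2 \<omega>)) \<partial>M) = \<infinity>"
proof -
  define h where "h = (\<lambda>x. - ln (1 - cdf F x))"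
  interpret cumulative_hazard h
    unfolding h_def by (rule cumulative_hazard_of_distribution[OF assms(1,2)])
  have h_lim: "filterlim h at_top at_top"
    unfolding h_def by (rule cumulative_hazard_of_distribution[OF assms(1,2)])
  from h_lim assms(5)
  obtain x :: "nat \<Rightarrow> real" where less: "\<And>n. x n < x (Suc n)"
    and growth: "\<And>n. h (x n) + real n \<le> h (x (Suc n))"
      "\<And>n. real n * exp (h (x n)) \<le> g (x (Suc n))"
    by (rule sparse_sequence_exists) blast
  define A where "A = (\<Union>k. {x (2 * k)<..x (Suc (2 * k))})"
  have A: "A \<in> sets borel" "- A \<in> sets borel"
    by (auto simp: A_def)
  have even_blocks: "{x (2 * k)<..x (Suc (2 * k))} \<subseteq> A" for k
    by (auto simp: A_def)
  have x_mono: "x i \<le> x j" if "i \<le> j" for i j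
    using less by (intro lift_Suc_mono_le[OF _ that]) (simp add: less_imp_le)
  have odd_blocks: "{x (Suc (2 * k))<..x (Suc (Suc (2 * k)))} \<inter> A = {}" for k
  proof -
    have separate: "x (Suc (2 * j)) \<le> x (Suc (2 * k)) \<or> x (Suc (Suc (2 * k))) \<le> x (2 * j)" for j
      by (cases "j \<le> k") (auto intro!: x_mono)
    have "{x (Suc (2 * k))<..x (Suc (Suc (2 * k)))} \<inter> {x (2 * j)<..x (Suc (2 * j))} = {}" for j
      using separate[of j] by (force simp: disjoint_iff)
    then show ?thesis
      unfolding A_def by blast
  qed
  have inside: "\<exists>n\<ge>N. {x n<..x (Suc n)} \<subseteq> A" for N
    using even_blocks[of N] by (intro exI[of _ "2 * N"]) auto
  have outside: "\<exists>n\<ge>N. {x n<..x (Suc n)} \<inter> A = {}" for N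
    using odd_blocks[of N] by (intro exI[of _ "Suc (2 * N)"]) auto
  obtain P where P: "real_distribution P" "\<And>y. cdf P y = 1 - exp (- part A y)"
      "(\<integral>\<^sup>+ y. ennreal (g y) \<partial>P) = \<infinity>"
    by (rule heavy_distribution_of_part[OF A(1) assms(3,4) less growth inside outside]) blast
  have inside': "\<exists>n\<ge>N. {x n<..x (Suc n)} \<subseteq> - A" for N
    using outside[of N] by (simp add: disjoint_eq_subset_Compl)
  have outside': "\<exists>n\<ge>N. {x n<..x (Suc n)} \<inter> - A = {}" for N
    using inside[of N] by (simp add: disjoint_eq_subset_Compl)
  obtain Q where Q: "real_distribution Q" "\<And>y. cdf Q y = 1 - exp (- part (- A) y)"
      "(\<integral>\<^sup>+ y. ennreal (g y) \<partial>Q) = \<infinity>"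
    by (rule heavy_distribution_of_part[OF A(2) assms(3,4) less growth inside' outside']) blast
  note product = coordinates_of_product_distribution[OF P(1) Q(1)]
  interpret PQ: prob_space "P \<Otimes>\<^sub>M Q"
    by (rule product)
  have meas [measurable]: "fst \<in> borel_measurable (P \<Otimes>\<^sub>M Q)" "snd \<in> borel_measurable (P \<Otimes>\<^sub>M Q)"
    using product(4) PQ.indep_var_rv1 PQ.indep_var_rv2 by blast+
  have [measurable]: "g \<in> borel_measurable borel"
    using assms(4) by (rule borel_measurable_mono)
  have "distr (P \<Otimes>\<^sub>M Q) borel (\<lambda>\<omega>. min (fst \<omega>) (snd \<omega>)) = F"
  proof (rule cdf_unique)
    show "cdf (distr (P \<Otimes>\<^sub>M Q) borel (\<lambda>\<omega>. min (fst \<omega>) (snd \<omega>))) = cdf F"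
    proof
      fix y
      have "exp (- part A y) * exp (- part (- A) y) = exp (- h y)"
        using part_add_part_Compl[OF A(1), of y] by (simp flip: exp_add)
      also have "\<dots> = 1 - cdf F y"
        using assms(2) by (simp add: h_def)
      finally show "cdf (distr (P \<Otimes>\<^sub>M Q) borel (\<lambda>\<omega>. min (fst \<omega>) (snd \<omega>))) y = cdf F y"
        by (simp add: product(5) P(2) Q(2))
    qed
  qed (use assms(1) in simp_all)
  moreover have "(\<integral>\<^sup>+ \<omega>. ennreal (g (fst \<omega>)) \<partial>(P \<Otimes>\<^sub>M Q)) = \<infinity>"
  proof -
    have "(\<integral>\<^sup>+ y. ennreal (g y) \<partial>distr (P \<Otimes>\<^sub>M Q) borel fst) =
        (\<integral>\<^sup>+ \<omega>. ennreal (g (fst \<omega>)) \<partial>(P \<Otimes>\<^sub>M Q))"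
      by (rule nn_integral_distr) measurable
    then show ?thesis
      by (simp add: product(2) P(3))
  qed
  moreover have "(\<integral>\<^sup>+ \<omega>. ennreal (g (snd \<omega>)) \<partial>(P \<Otimes>\<^sub>M Q)) = \<infinity>"
  proof -
    have "(\<integral>\<^sup>+ y. ennreal (g y) \<partial>distr (P \<Otimes>\<^sub>M Q) borel snd) =
        (\<integral>\<^sup>+ \<omega>. ennreal (g (snd \<omega>)) \<partial>(P \<Otimes>\<^sub>M Q))"
      by (rule nn_integral_distr) measurable
    then show ?thesis
      by (simp add: product(3) Q(3))
  qed
  ultimately show ?thesis
    using product(1,4) meas by blast
qed

end
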